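(* Let $q$ be an odd prime power, $N_0=\mathbb{F}_q^2$, $H_0=SO_2(\mathbb{F}_q)=\left\{\begin{pmatrix}a&-b\\ b&a\end{pmatrix}: a^2+b^2=1\right\}$, and $G_0=\{(z,h):z\in N_0,h\in H_0\}$ with multiplication $(z_1,h_1)(z_2,h_2)=(z_1+h_1z_2,h_1h_2)$. For $g=(z,h)\in G_0$ write $\dot g=h$. For any $X,Y,Z\subseteq G_0$, \[ \left|\#\{(x,y,z)\in X\times Y\times Z: xy=z\}-\frac{\dot{\mathcal{M}}_2}{q^2}\right|\le q\sqrt{|X||Y||Z|}, \] where $\dot{\mathcal{M}}_2=\#\{(x,y,z)\in X\times Y\times Z:\ \dot x\dot y=\dot z\}$. *)

theory Defs
  imports "HOL-Analysis.Cartesian_Space" "HOL-Number_Theory.Prime_Powers"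
begin

type_synonym 'a motion = "('a ^ 2) \<times> ('a ^ 2 ^ 2)"

definition SO2 :: "('a::field ^ 2 ^ 2) set" where
  "SO2 = {vector [vector [a, - b], vector [b, a]] | a b. a\<^sup>2 + b\<^sup>2 = 1}"

definition G0 :: "'a::field motion set" where
  "G0 = UNIV \<times> SO2"

definition G0_mult :: "'a::field motion \<Rightarrow> 'a motion \<Rightarrow> 'a motion"  (infixl "\<odot>" 70) where
  "g \<odot> g' = (fst g + snd g *v fst g', snd g ** snd g')"

definition M2_dot :: "'a::field motion set \<Rightarrow> 'a motion set \<Rightarrow> 'a motion set \<Rightarrow> nat" where
  "M2_dot X Y Z = card {(x, y, z) \<in> X \<times> Y \<times> Z. snd x ** snd y = snd z}"

end

(* Detecting the translation part of x y = z with the additive characters of F_q^2 gives one term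
   per frequency xi; the frequency 0 is the main term M_2 / q^2. With k, l the rotations of y and z,
   the term at xi is a bilinear form in (k, l) whose kernel is the Fourier transform of the fibre of
   X over l k^-1, evaluated at l xi. For xi \<noteq> 0 the frequencies l xi are pairwise distinct (q is odd),
   so Plancherel bounds the Hilbert-Schmidt norm of the kernel by q sqrt |X|; Cauchy-Schwarz and
   Plancherel over xi then take care of Y and Z. *)
theory Submission
  imports Defs "HOL-Number_Theory.Cong" "HOL-Analysis.Complex_Transcendental" "HOL-Analysis.L2_Norm"
begin


section \<open>Construction of a nontrivial additive character\<close>

lemma power_eq_if_cong_root_of_unity:
  fixes w :: "'a::monoid_mult"
  assumes "w ^ p = 1" and "[k = k'] (mod p)"
  shows "w ^ k = w ^ k'"
proof -
  have *: "w ^ n = w ^ (n mod p)" for n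
  proof -
    have "w ^ n = w ^ (p * (n div p) + n mod p)"
      by simp
    also have "\<dots> = w ^ (n mod p)"
      unfolding power_add power_mult assms(1) by simp
    finally show ?thesis .
  qed
  show ?thesis
    using assms(2) *[of k] *[of k'] by (simp add: cong_def)
qed

(* The character is trivial on a maximal proper additive subgroup, which has index CHAR('a). *)
lemma exists_nontrivial_additive_character:
  "\<exists>\<psi> :: 'a::{field, finite} \<Rightarrow> complex. \<psi> 0 = 1 \<and> (\<forall>a b. \<psi> (a + b) = \<psi> a * \<psi> b) \<and> (\<exists>a. \<psi> a \<noteq> 1)"
proof -
  define p where "p = CHAR('a)"
  have "p > 0"
    unfolding p_def by (rule finite_imp_CHAR_pos) simp
  hence "prime p"
    unfolding p_def by (rule prime_CHAR_semidom)
  have p0: "of_nat p = (0 :: 'a)"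
    by (simp add: p_def)
  have p1: "of_nat (p - 1) = (- 1 :: 'a)"
    using \<open>p > 0\<close> p0 by (simp add: of_nat_diff del: One_nat_def)
  \<comment> \<open>Closure under sums is enough to describe subgroups here: \<open>- m\<close> is
    the sum of \<open>p - 1\<close> copies of \<open>m\<close>.\<close>
  define S where "S = {M :: 'a set. 0 \<in> M \<and> (\<forall>a\<in>M. \<forall>b\<in>M. a + b \<in> M) \<and> M \<noteq> UNIV}"
  have "finite S"
    by (rule finite_subset[of _ UNIV]) auto
  moreover have "{0} \<in> S"
    unfolding S_def using zero_neq_one[where ?'a = 'a] by (auto simp: set_eq_iff intro!: exI[of _ 1])
  ultimately obtain M where M: "M \<in> S" and max: "\<And>N. N \<in> S \<Longrightarrow> M \<subseteq> N \<Longrightarrow> M = N"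
    using finite_has_maximal[of S] by blast
  from M have M0: "0 \<in> M" and Madd: "\<And>a b. a \<in> M \<Longrightarrow> b \<in> M \<Longrightarrow> a + b \<in> M" and "M \<noteq> UNIV"
    by (auto simp: S_def)
  have Mmult: "of_nat k * m \<in> M" if "m \<in> M" for k m
    by (induction k) (auto simp: M0 Madd that distrib_right)
  have Mminus: "- m \<in> M" if "m \<in> M" for m
  proof -
    have "- m = of_nat (p - 1) * m"
      using p1 by simp
    thus ?thesis
      using Mmult[OF that] by simp
  qed
  from \<open>M \<noteq> UNIV\<close> obtain x where "x \<notin> M"
    by auto
  have ex: "\<exists>k. \<exists>m\<in>M. y = m + of_nat k * x" for y
  proof -
    \<comment> \<open>\<open>N\<close> is the subgroup generated by \<open>M\<close> and
      \<open>x\<close>; as it is strictly larger than \<open>M\<close>, maximality leaves only the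
      whole field.\<close>
    define N where "N = {m + of_nat k * x | m k. m \<in> M}"
    have sub: "M \<subseteq> N"
      unfolding N_def by (force intro: exI[of _ 0])
    have "x \<in> N"
      unfolding N_def using M0 by (force intro: exI[of _ 0] exI[of _ 1])
    hence "M \<noteq> N"
      using \<open>x \<notin> M\<close> by auto
    have add: "a + b \<in> N" if "a \<in> N" "b \<in> N" for a b
    proof -
      from that obtain m k m' k' where "a = m + of_nat k * x" "b = m' + of_nat k' * x" "m \<in> M" "m' \<in> M"
        unfolding N_def by auto
      hence "a + b = (m + m') + of_nat (k + k') * x" "m + m' \<in> M"
        by (auto simp: algebra_simps Madd)
      thus ?thesis
        unfolding N_def by blast
    qed
    have "N \<notin> S"
      using max[OF _ sub] \<open>M \<noteq> N\<close> by auto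
    hence "N = UNIV"
      using add sub M0 unfolding S_def by blast
    thus ?thesis
      unfolding N_def by blast
  qed
  have uniq: "[k = k'] (mod p)"
    if "m + of_nat k * x = m' + of_nat k' * x" "m \<in> M" "m' \<in> M" for m m' k k'
  proof -
    \<comment> \<open>A natural number that represents k - k' in the field. If \<open>p\<close> did
      not divide it, an inverse of \<open>d\<close> modulo \<open>p\<close> would carry
      \<open>of_nat d * x\<close>, which lies in \<open>M\<close>, to \<open>x\<close>, which does
      not.\<close>
    define d where "d = k + (p - 1) * k'"
    have d: "of_nat d = (of_nat k - of_nat k' :: 'a)"
      unfolding d_def of_nat_add of_nat_mult p1 by simp
    have "of_nat d * x = m' + - m"
      unfolding d using that(1) by (simp add: algebra_simps)
    hence dM: "of_nat d * x \<in> M"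
      using that by (simp add: Madd Mminus del: add_uminus_conv_diff)
    have "p dvd d"
    proof (rule ccontr)
      assume "\<not> p dvd d"
      hence "coprime d p"
        using \<open>prime p\<close> prime_imp_coprime_nat coprime_commute by blast
      then obtain e where "[d * e = 1] (mod p)"
        using cong_solve_coprime_nat[of d p] by auto
      hence "of_nat (d * e) = (of_nat 1 :: 'a)"
        unfolding p_def by (simp only: of_nat_eq_iff_cong_CHAR)
      moreover have "of_nat e * (of_nat d * x) = of_nat (d * e) * x"
        by (simp add: mult_ac)
      ultimately have "of_nat e * (of_nat d * x) = x"
        by (simp only: of_nat_1 mult_1)
      thus False
        using Mmult[OF dM, of e] \<open>x \<notin> M\<close> by metis
    qed
    hence "of_nat k = (of_nat k' :: 'a)"
      using d by (metis of_nat_eq_0_iff_char_dvd p_def eq_iff_diff_eq_0)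
    thus ?thesis
      unfolding p_def by (simp only: of_nat_eq_iff_cong_CHAR)
  qed
  define w where "w = exp (2 * of_real pi * \<i> * of_nat 1 / of_nat p)"
  have wp: "w ^ p = 1"
    unfolding w_def using \<open>p > 0\<close> by (intro complex_root_unity) simp
  \<comment> \<open>The exponent is determined modulo \<open>p\<close> by \<open>uniq\<close>, and
    \<open>w ^ p = 1\<close>, so the choice made by \<open>SOME\<close> does not affect the
    value.\<close>
  define \<psi> where "\<psi> y = w ^ (SOME k. \<exists>m\<in>M. y = m + of_nat k * x)" for y
  have \<psi>: "\<psi> (m + of_nat k * x) = w ^ k" if "m \<in> M" for m k
  proof -
    define k' where "k' = (SOME k'. \<exists>m'\<in>M. m + of_nat k * x = m' + of_nat k' * x)"
    have "\<exists>m'\<in>M. m + of_nat k * x = m' + of_nat k' * x"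
      unfolding k'_def by (rule someI_ex) (use that in blast)
    then obtain m' where "m' + of_nat k' * x = m + of_nat k * x" "m' \<in> M"
      by metis
    hence "[k' = k] (mod p)"
      using that by (rule uniq)
    thus ?thesis
      unfolding \<psi>_def k'_def[symmetric] by (rule power_eq_if_cong_root_of_unity[OF wp])
  qed
  have "\<psi> (a + b) = \<psi> a * \<psi> b" for a b
  proof -
    obtain k m k' m' where *: "m \<in> M" "a = m + of_nat k * x" "m' \<in> M" "b = m' + of_nat k' * x"
      using ex by metis
    hence "a + b = (m + m') + of_nat (k + k') * x"
      by (simp add: algebra_simps)
    hence "\<psi> (a + b) = w ^ (k + k')"
      using \<psi>[of "m + m'" "k + k'"] Madd[OF *(1,3)] by simp
    moreover have "\<psi> a = w ^ k" "\<psi> b = w ^ k'"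
      using \<psi> * by simp_all
    ultimately show ?thesis
      by (simp only: power_add)
  qed
  moreover have "\<psi> 0 = 1"
    using \<psi>[OF M0, of 0] by simp
  moreover have "\<psi> x \<noteq> 1"
    using \<psi>[OF M0, of 1] complex_root_unity_eq_1[of p 1] prime_gt_1_nat[OF \<open>prime p\<close>] by (simp add: w_def)
  ultimately show ?thesis
    by blast
qed


section \<open>The bilinear form and its rotations\<close>

definition dot :: "'a::field ^ 'n \<Rightarrow> 'a ^ 'n \<Rightarrow> 'a" where
  "dot x y = (\<Sum>i\<in>UNIV. x $ i * y $ i)"

lemma dot_add_right: "dot x (y + z) = dot x y + dot x z"
  by (simp add: dot_def distrib_left sum.distrib)

lemma dot_add_left: "dot (x + y) z = dot x z + dot y z"
  by (simp add: dot_def distrib_right sum.distrib)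

lemma dot_minus_right: "dot x (- y) = - dot x y"
  by (simp add: dot_def sum_negf)

lemma dot_zero_left [simp]: "dot 0 y = 0"
  by (simp add: dot_def)

lemma dot_zero_right [simp]: "dot x 0 = 0"
  by (simp add: dot_def)

text \<open>Nondegeneracy of the form, by scaling the coordinate vector at a nonzero entry of
  \<open>z\<close>. It provides the translation that makes nontrivial character sums vanish.\<close>

lemma dot_surj:
  assumes "z \<noteq> 0"
  shows "\<exists>w. dot w z = c"
proof -
  from assms obtain i where "z $ i \<noteq> 0"
    by (auto simp: vec_eq_iff)
  hence "dot (\<chi> j. if j = i then c / z $ i else 0) z = c"
    by (simp add: dot_def if_distrib[of "\<lambda>x. x * _"] cong: if_cong)
  thus ?thesis ..
qed

lemma SO2_E:
  assumes "h \<in> SO2"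
  obtains a b where "h = vector [vector [a, - b], vector [b, a]]" "a\<^sup>2 + b\<^sup>2 = 1"
  using assms by (auto simp: SO2_def)

lemma SO2_I:
  assumes "h $ 1 $ 1 = a" "h $ 1 $ 2 = - b" "h $ 2 $ 1 = b" "h $ 2 $ 2 = a" "a\<^sup>2 + b\<^sup>2 = 1"
  shows "h \<in> SO2"
  unfolding SO2_def using assms by (auto simp: vec_eq_iff forall_2 intro!: exI[of _ a] exI[of _ b])

lemma SO2_mult: "h ** k \<in> SO2" if "h \<in> SO2" "k \<in> SO2"
proof -
  obtain a b where h: "h = vector [vector [a, - b], vector [b, a]]" "a\<^sup>2 + b\<^sup>2 = 1"
    using \<open>h \<in> SO2\<close> by (rule SO2_E)
  obtain c d where k: "k = vector [vector [c, - d], vector [d, c]]" "c\<^sup>2 + d\<^sup>2 = 1"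
    using \<open>k \<in> SO2\<close> by (rule SO2_E)
  \<comment> \<open>Brahmagupta's identity: rotations multiply like elements a + b i of norm
    1.\<close>
  have "(a * c - b * d)\<^sup>2 + (a * d + b * c)\<^sup>2 = (a\<^sup>2 + b\<^sup>2) * (c\<^sup>2 + d\<^sup>2)"
    by algebra
  thus ?thesis
    by (intro SO2_I[of _ "a * c - b * d" "a * d + b * c"])
       (auto simp: h k matrix_matrix_mult_def sum_2)
qed

lemma SO2_transpose:
  assumes "h \<in> SO2"
  shows "transpose h \<in> SO2"
proof -
  obtain a b where h: "h = vector [vector [a, - b], vector [b, a]]" "a\<^sup>2 + b\<^sup>2 = 1"
    using assms by (rule SO2_E)
  show ?thesis
    by (rule SO2_I[of _ a "- b"]) (use h in \<open>auto simp: transpose_def\<close>)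
qed

text \<open>Hence \<open>transpose h\<close> is the inverse of \<open>h\<close>, and it is written
  in this role from here on.\<close>

lemma SO2_transpose_mult_self:
  assumes "h \<in> SO2"
  shows "transpose h ** h = mat 1" and "h ** transpose h = mat 1"
proof -
  obtain a b where h: "h = vector [vector [a, - b], vector [b, a]]" "a\<^sup>2 + b\<^sup>2 = 1"
    using assms by (rule SO2_E)
  have "a * a + b * b = 1" "b * b + a * a = 1"
    using h(2) by (simp_all add: power2_eq_square add.commute)
  thus "transpose h ** h = mat 1" "h ** transpose h = mat 1"
    unfolding h(1) by (auto simp: vec_eq_iff forall_2 matrix_matrix_mult_def transpose_def sum_2 mat_def)
qed

lemma dot_SO2:
  assumes "h \<in> SO2"
  shows "dot (h *v x) (h *v y) = dot x y"
proof -
  obtain a b where h: "h = vector [vector [a, - b], vector [b, a]]" "a\<^sup>2 + b\<^sup>2 = 1"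
    using assms by (rule SO2_E)
  have "dot (h *v x) (h *v y) = (a\<^sup>2 + b\<^sup>2) * dot x y"
    unfolding h(1) by (simp add: dot_def sum_2 matrix_vector_mult_def) algebra
  thus ?thesis
    by (simp add: h(2))
qed

lemma bij_SO2: "bij ((*v) h)" if "h \<in> SO2"
  by (rule bij_betw_byWitness[of _ "(*v) (transpose h)"])
     (auto simp: matrix_vector_mul_assoc SO2_transpose_mult_self[OF that]
           simp del: transpose_matrix_vector)

(* For h = (a, b) and k = (c, d) with h \<noteq> k the matrix h - k has determinant
   (a - c)^2 + (b - d)^2 = 2 (1 - a c - b d); it vanishes only for a c + b d = 1, which forces
   b c = a d and hence (a, b) = (c, d). *)
lemma SO2_action_free:
  fixes h k :: "'a::field ^ 2 ^ 2"
  assumes "h \<in> SO2" "k \<in> SO2" "h *v x = k *v x" "x \<noteq> 0" "(2 :: 'a) \<noteq> 0"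
  shows "h = k"
proof -
  obtain a b where h: "h = vector [vector [a, - b], vector [b, a]]" "a\<^sup>2 + b\<^sup>2 = 1"
    using assms(1) by (rule SO2_E)
  obtain c d where k: "k = vector [vector [c, - d], vector [d, c]]" "c\<^sup>2 + d\<^sup>2 = 1"
    using assms(2) by (rule SO2_E)
  have eq: "a * x $ 1 - b * x $ 2 = c * x $ 1 - d * x $ 2" "b * x $ 1 + a * x $ 2 = d * x $ 1 + c * x $ 2"
    using assms(3) unfolding h(1) k(1) by (simp_all add: vec_eq_iff forall_2 matrix_vector_mult_def sum_2)
  define D where "D = (a - c)\<^sup>2 + (b - d)\<^sup>2"
  \<comment> \<open>Multiply (h - k) x = 0 by the adjugate of h - k.\<close>
  have "D * x $ 1 = 0" "D * x $ 2 = 0"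
    unfolding D_def using eq by algebra+
  hence "D = 0"
    using \<open>x \<noteq> 0\<close> by (auto simp: vec_eq_iff forall_2)
  hence "2 * (1 - (a * c + b * d)) = 0"
    using h(2) k(2) unfolding D_def by algebra
  hence "1 - (a * c + b * d) = 0"
    using \<open>2 \<noteq> 0\<close> mult_eq_0_iff by blast
  hence *: "a * c + b * d = 1"
    by simp
  hence "(b * c - a * d)\<^sup>2 = 0"
    using h(2) k(2) by algebra
  hence "b * c = a * d"
    by simp
  hence "a = c" "b = d"
    using * h(2) k(2) by algebra+
  thus ?thesis
    by (simp add: h k)
qed

text \<open>Shifting by 1 permutes the field, so the sum of all elements absorbs
  \<open>CARD('a)\<close> copies of 1; thus the cardinality is 0 in the field. If it is odd and 2 =
  0, this says 1 = 0.\<close>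

lemma two_neq_zero_if_odd_CARD:
  assumes "odd CARD('a::{field, finite})"
  shows "(2 :: 'a) \<noteq> 0"
proof
  assume two: "(2 :: 'a) = 0"
  have "(\<Sum>x\<in>UNIV. x :: 'a) = (\<Sum>x\<in>UNIV. x + 1)"
    by (rule sum.reindex_bij_witness[of _ "\<lambda>x. x + 1" "\<lambda>x. x - 1"]) auto
  hence "of_nat CARD('a) = (0 :: 'a)"
    by (simp add: sum.distrib)
  moreover obtain k where "CARD('a) = 2 * k + 1"
    using assms by (rule oddE)
  ultimately show False
    using two by simp
qed


section \<open>Sums over triples, organised by rotation\<close>

definition fiber :: "'a motion set \<Rightarrow> 'a ^ 2 ^ 2 \<Rightarrow> ('a ^ 2) set" where
  "fiber X h = {z. (z, h) \<in> X}"

lemma sum_eq_sum_fibers: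
  fixes X :: "'a::{field, finite} motion set"
  assumes "X \<subseteq> G0"
  shows "(\<Sum>x\<in>X. f x) = (\<Sum>h\<in>SO2. \<Sum>z\<in>fiber X h. f (z, h))"
proof -
  have "(\<Sum>h\<in>SO2. \<Sum>z\<in>fiber X h. f (z, h)) = (\<Sum>(h, z)\<in>Sigma SO2 (fiber X). f (z, h))"
    by (rule sum.Sigma) auto
  also have "\<dots> = (\<Sum>x\<in>X. f x)"
    by (rule sum.reindex_bij_witness[of _ prod.swap prod.swap])
       (use assms in \<open>auto simp: fiber_def G0_def\<close>)
  finally show ?thesis ..
qed

lemma card_eq_sum_fibers:
  fixes X :: "'a::{field, finite} motion set"
  assumes "X \<subseteq> G0"
  shows "card X = (\<Sum>h\<in>SO2. card (fiber X h))"
  using sum_eq_sum_fibers[OF assms, of "\<lambda>_. 1 :: nat"] by simp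

lemma SO2_mult_eq_iff:
  assumes "k \<in> SO2"
  shows "h ** k = l \<longleftrightarrow> h = l ** transpose k"
  using SO2_transpose_mult_self[OF assms] by (metis matrix_mul_assoc matrix_mul_rid)

text \<open>The constraint forces the rotation of \<open>x\<close> to be l k^-1, so only the
  rotations of \<open>y\<close> and \<open>z\<close> remain free. The weight \<open>F\<close> is
  kept general to serve both the plain count \<open>M2_dot\<close> and the character sums.\<close>

lemma sum_matching_triples_eq_sum_fibers:
  fixes X Y Z :: "'a::{field, finite} motion set"
    and F :: "'a motion \<Rightarrow> 'a motion \<Rightarrow> 'a motion \<Rightarrow> 'b::comm_monoid_add"
  assumes "X \<subseteq> G0" "Y \<subseteq> G0" "Z \<subseteq> G0"
  shows "(\<Sum>x\<in>X. \<Sum>y\<in>Y. \<Sum>z\<in>Z. if snd x ** snd y = snd z then F x y z else 0) =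
         (\<Sum>k\<in>SO2. \<Sum>l\<in>SO2. \<Sum>u\<in>fiber X (l ** transpose k). \<Sum>v\<in>fiber Y k. \<Sum>w\<in>fiber Z l.
            F (u, l ** transpose k) (v, k) (w, l))"
proof -
  have "(\<Sum>x\<in>X. \<Sum>y\<in>Y. \<Sum>z\<in>Z. if snd x ** snd y = snd z then F x y z else 0) =
        (\<Sum>y\<in>Y. \<Sum>z\<in>Z. \<Sum>x\<in>X. if snd x ** snd y = snd z then F x y z else 0)"
    by (subst sum.swap) (intro sum.cong sum.swap refl)
  also have "\<dots> = (\<Sum>k\<in>SO2. \<Sum>v\<in>fiber Y k. \<Sum>l\<in>SO2. \<Sum>w\<in>fiber Z l. \<Sum>h\<in>SO2. \<Sum>u\<in>fiber X h.
      if h ** k = l then F (u, h) (v, k) (w, l) else 0)"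
    by (simp add: sum_eq_sum_fibers assms)
  also have "\<dots> = (\<Sum>k\<in>SO2. \<Sum>v\<in>fiber Y k. \<Sum>l\<in>SO2. \<Sum>w\<in>fiber Z l. \<Sum>h\<in>SO2.
      if h = l ** transpose k then \<Sum>u\<in>fiber X h. F (u, h) (v, k) (w, l) else 0)"
    by (intro sum.cong refl) (auto simp: SO2_mult_eq_iff)
  also have "\<dots> = (\<Sum>k\<in>SO2. \<Sum>v\<in>fiber Y k. \<Sum>l\<in>SO2. \<Sum>w\<in>fiber Z l.
      \<Sum>u\<in>fiber X (l ** transpose k). F (u, l ** transpose k) (v, k) (w, l))"
    by (intro sum.cong refl) (simp add: sum.delta' SO2_mult SO2_transpose)
  also have "\<dots> = (\<Sum>k\<in>SO2. \<Sum>l\<in>SO2. \<Sum>v\<in>fiber Y k. \<Sum>u\<in>fiber X (l ** transpose k). \<Sum>w\<in>fiber Z l.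
      F (u, l ** transpose k) (v, k) (w, l))"
    by (subst sum.swap, intro sum.cong refl) (intro sum.swap)
  also have "\<dots> = (\<Sum>k\<in>SO2. \<Sum>l\<in>SO2. \<Sum>u\<in>fiber X (l ** transpose k). \<Sum>v\<in>fiber Y k. \<Sum>w\<in>fiber Z l.
      F (u, l ** transpose k) (v, k) (w, l))"
    by (intro sum.cong refl sum.swap)
  finally show ?thesis .
qed

lemma card_triples_eq_sum:
  assumes "finite X" "finite Y" "finite Z"
  shows "of_nat (card {(x, y, z) \<in> X \<times> Y \<times> Z. P x y z}) =
         (\<Sum>x\<in>X. \<Sum>y\<in>Y. \<Sum>z\<in>Z. if P x y z then 1 else (0 :: 'b::semiring_1))"
proof -
  have "(\<Sum>x\<in>X. \<Sum>y\<in>Y. \<Sum>z\<in>Z. if P x y z then 1 else (0 :: 'b)) =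
        (\<Sum>t\<in>X \<times> Y \<times> Z. if (case t of (x, y, z) \<Rightarrow> P x y z) then 1 else 0)"
    by (simp add: sum.cartesian_product case_prod_unfold)
  also have "\<dots> = (\<Sum>t\<in>{t \<in> X \<times> Y \<times> Z. case t of (x, y, z) \<Rightarrow> P x y z}. 1)"
    by (subst sum.inter_filter) (use assms in auto)
  also have "\<dots> = of_nat (card {t \<in> X \<times> Y \<times> Z. case t of (x, y, z) \<Rightarrow> P x y z})"
    by simp
  also have "{t \<in> X \<times> Y \<times> Z. case t of (x, y, z) \<Rightarrow> P x y z} = {(x, y, z) \<in> X \<times> Y \<times> Z. P x y z}"
    by auto
  finally show ?thesis ..
qed

text \<open>With \<open>i\<close> a frequency and \<open>u\<close>, \<open>v\<close>,
  \<open>w\<close> points of three fibres, this turns a sum of characters into products of Fourier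
  transforms.\<close>

lemma sum_product3_swap:
  fixes a b c :: "'i \<Rightarrow> 'j \<Rightarrow> 'b::comm_semiring_0"
  shows "(\<Sum>u\<in>A. \<Sum>v\<in>B. \<Sum>w\<in>C. \<Sum>i\<in>I. a i u * b i v * c i w) =
         (\<Sum>i\<in>I. (\<Sum>u\<in>A. a i u) * (\<Sum>v\<in>B. b i v) * (\<Sum>w\<in>C. c i w))"
proof -
  have "(\<Sum>i\<in>I. (\<Sum>u\<in>A. a i u) * (\<Sum>v\<in>B. b i v) * (\<Sum>w\<in>C. c i w)) =
        (\<Sum>i\<in>I. \<Sum>u\<in>A. \<Sum>v\<in>B. \<Sum>w\<in>C. a i u * b i v * c i w)"
    by (rule sum.cong[OF refl], subst sum_product, simp only: sum_distrib_right, simp only: sum_distrib_left)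
  also have "\<dots> = (\<Sum>u\<in>A. \<Sum>i\<in>I. \<Sum>v\<in>B. \<Sum>w\<in>C. a i u * b i v * c i w)"
    by (rule sum.swap)
  also have "\<dots> = (\<Sum>u\<in>A. \<Sum>v\<in>B. \<Sum>i\<in>I. \<Sum>w\<in>C. a i u * b i v * c i w)"
    by (intro sum.cong refl sum.swap)
  also have "\<dots> = (\<Sum>u\<in>A. \<Sum>v\<in>B. \<Sum>w\<in>C. \<Sum>i\<in>I. a i u * b i v * c i w)"
    by (intro sum.cong refl sum.swap)
  finally show ?thesis ..
qed

section \<open>Fourier analysis with an additive character\<close>

locale additive_character =
  fixes \<psi> :: "'a::{field, finite} \<Rightarrow> complex"
  assumes zero [simp]: "\<psi> 0 = 1"
    and add: "\<psi> (a + b) = \<psi> a * \<psi> b"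
    and nontrivial: "\<exists>a. \<psi> a \<noteq> 1"
begin

text \<open>Adding \<open>a\<close> to itself \<open>CHAR('a)\<close> times gives 0, so
  \<open>\<psi> a\<close> is a root of unity.\<close>

lemma norm_eq_1 [simp]: "cmod (\<psi> a) = 1"
proof -
  have "\<psi> a ^ n = \<psi> (of_nat n * a)" for n
    by (induction n) (simp_all add: add distrib_right)
  hence "\<psi> a ^ CHAR('a) = 1"
    by simp
  moreover have "CHAR('a) > 0"
    by (rule finite_imp_CHAR_pos) simp
  ultimately show ?thesis
    using power_eq_1_iff by fastforce
qed

lemma uminus: "\<psi> (- a) = cnj (\<psi> a)"
proof -
  have "\<psi> a * \<psi> (- a) = \<psi> a * cnj (\<psi> a)"
    using add[of a "- a"] complex_norm_square[of "\<psi> a"] by simp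
  moreover have "\<psi> a \<noteq> 0"
    using norm_eq_1[of a] by (metis norm_zero zero_neq_one)
  ultimately show ?thesis
    by simp
qed

text \<open>Orthogonality: for \<open>z\<close> nonzero, a translation of \<open>x\<close>
  multiplies the sum by a factor other than 1 without changing it, so the sum is 0.\<close>

lemma sum_dot: "(\<Sum>x\<in>UNIV. \<psi> (dot x z)) = (if z = 0 then of_nat CARD('a ^ 'n) else 0)"
  for z :: "'a ^ 'n"
proof (cases "z = 0")
  case False
  obtain c where c: "\<psi> c \<noteq> 1"
    using nontrivial by blast
  obtain w where w: "dot w z = c"
    using dot_surj[OF False] by blast
  have "(\<Sum>x\<in>UNIV. \<psi> (dot x z)) = (\<Sum>x\<in>UNIV. \<psi> (dot (x + w) z))"
    by (rule sum.reindex_bij_witness[of _ "\<lambda>x. x + w" "\<lambda>x. x - w"]) auto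
  also have "\<dots> = (\<Sum>x\<in>UNIV. \<psi> (dot x z)) * \<psi> c"
    by (simp add: dot_add_left add w sum_distrib_right)
  finally show ?thesis
    using c False by simp
qed simp

text \<open>The Fourier transform of the indicator function of \<open>A\<close>, unnormalised; hence
  the factor \<open>CARD('a ^ 'n)\<close> in Plancherel's identity.\<close>

definition ft :: "('a ^ 'n) set \<Rightarrow> 'a ^ 'n \<Rightarrow> complex" where
  "ft A \<xi> = (\<Sum>z\<in>A. \<psi> (dot \<xi> z))"

lemma ft_0 [simp]: "ft A 0 = of_nat (card A)"
  by (simp add: ft_def)

text \<open>Expanding the square gives a sum over pairs in \<open>A\<close>, and orthogonality
  leaves only the diagonal.\<close>

lemma plancherel:
  fixes A :: "('a ^ 'n) set"
  shows "(\<Sum>\<xi>\<in>UNIV. (cmod (ft A \<xi>))\<^sup>2) = CARD('a ^ 'n) * card A"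
proof -
  have "complex_of_real (\<Sum>\<xi>\<in>UNIV. (cmod (ft A \<xi>))\<^sup>2) = (\<Sum>\<xi>\<in>UNIV. ft A \<xi> * cnj (ft A \<xi>))"
    unfolding of_real_sum by (intro sum.cong refl complex_norm_square)
  also have "\<dots> = (\<Sum>\<xi>\<in>UNIV. \<Sum>y\<in>A. \<Sum>z\<in>A. \<psi> (dot \<xi> (y - z)))"
    by (simp add: ft_def sum_product diff_conv_add_uminus dot_add_right dot_minus_right add uminus
          del: add_uminus_conv_diff)
  also have "\<dots> = (\<Sum>y\<in>A. \<Sum>\<xi>\<in>UNIV. \<Sum>z\<in>A. \<psi> (dot \<xi> (y - z)))"
    by (rule sum.swap)
  also have "\<dots> = (\<Sum>y\<in>A. \<Sum>z\<in>A. \<Sum>\<xi>\<in>UNIV. \<psi> (dot \<xi> (y - z)))"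
    by (intro sum.cong refl sum.swap)
  also have "\<dots> = (\<Sum>y\<in>A. \<Sum>z\<in>A. if y = z then of_nat CARD('a ^ 'n) else 0)"
    by (simp only: sum_dot right_minus_eq)
  also have "\<dots> = complex_of_real (CARD('a ^ 'n) * card A)"
    by (simp add: sum.delta)
  finally show ?thesis
    by (simp only: of_real_eq_iff)
qed

section \<open>Decomposition of the count by frequency\<close>

definition phase_sum :: "'a motion set \<Rightarrow> 'a motion set \<Rightarrow> 'a motion set \<Rightarrow> 'a ^ 2 \<Rightarrow> complex" where
  "phase_sum X Y Z \<xi> = (\<Sum>k\<in>SO2. \<Sum>l\<in>SO2. ft (fiber X (l ** transpose k)) (l *v \<xi>) *
                 ft (fiber Y k) (k *v \<xi>) * cnj (ft (fiber Z l) (l *v \<xi>)))"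

text \<open>At frequency 0 each transform is the size of its fibre, so only the condition on the
  rotations is counted.\<close>

lemma phase_sum_0:
  assumes "X \<subseteq> G0" "Y \<subseteq> G0" "Z \<subseteq> G0"
  shows "phase_sum X Y Z 0 = of_nat (M2_dot X Y Z)"
  unfolding phase_sum_def M2_dot_def
  by (subst card_triples_eq_sum; (simp add: sum_matching_triples_eq_sum_fibers[OF assms] mult.assoc)?)

text \<open>Fourier inversion, with the frequency in each term rotated to l \<xi>. This choice makes
  the factor from \<open>Y\<close> depend on \<open>k\<close> alone and the one from
  \<open>Z\<close> on \<open>l\<close> alone; only the factor from \<open>X\<close> couples
  them.\<close>

lemma sum_phase_sum:
  assumes "X \<subseteq> G0" "Y \<subseteq> G0" "Z \<subseteq> G0"
  shows "(\<Sum>\<xi>\<in>UNIV. phase_sum X Y Z \<xi>) =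
           of_nat CARD('a ^ 2) * of_nat (card {(x, y, z) \<in> X \<times> Y \<times> Z. x \<odot> y = z})"
proof -
  \<comment> \<open>Once the rotations match, orthogonality tests the equality of translations.
    Since \<open>snd z\<close> permutes the frequencies, it may be inserted in front of
    \<xi>.\<close>
  have detect: "of_nat CARD('a ^ 2) * (if x \<odot> y = z then 1 else 0) =
      (if snd x ** snd y = snd z
       then \<Sum>\<xi>\<in>UNIV. \<psi> (dot (snd z *v \<xi>) (fst x + snd x *v fst y - fst z)) else 0)"
    if "z \<in> Z" for x y z :: "'a motion"
  proof -
    have "snd z \<in> SO2"
      using that assms(3) by (auto simp: G0_def)
    hence "(\<Sum>\<xi>\<in>UNIV. \<psi> (dot (snd z *v \<xi>) t)) = (\<Sum>\<xi>\<in>UNIV. \<psi> (dot \<xi> t))" for t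
      by (intro sum.reindex_bij_betw[of "(*v) (snd z)"] bij_SO2)
    thus ?thesis
      by (auto simp: sum_dot G0_mult_def prod_eq_iff)
  qed
  \<comment> \<open>As l \<xi> = (l k^-1) (k \<xi>), invariance of \<open>dot\<close> moves the
    rotation off \<open>v\<close> and leaves the frequency k \<xi>.\<close>
  have phase: "\<psi> (dot (l *v \<xi>) (u + (l ** transpose k) *v v - w)) =
      \<psi> (dot (l *v \<xi>) u) * \<psi> (dot (k *v \<xi>) v) * cnj (\<psi> (dot (l *v \<xi>) w))"
    if "k \<in> SO2" "l \<in> SO2" for k l u v w \<xi>
  proof -
    have "l *v \<xi> = (l ** transpose k) *v (k *v \<xi>)"
      using SO2_transpose_mult_self(1)[OF \<open>k \<in> SO2\<close>]
      by (simp add: matrix_vector_mul_assoc flip: matrix_mul_assoc)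
    hence "dot (l *v \<xi>) ((l ** transpose k) *v v) = dot (k *v \<xi>) v"
      using that by (simp only: dot_SO2 SO2_mult SO2_transpose)
    thus ?thesis
      by (simp add: diff_conv_add_uminus dot_add_right dot_minus_right add uminus
            del: add_uminus_conv_diff)
  qed
  have "of_nat CARD('a ^ 2) * of_nat (card {(x, y, z) \<in> X \<times> Y \<times> Z. x \<odot> y = z}) =
    (\<Sum>x\<in>X. \<Sum>y\<in>Y. \<Sum>z\<in>Z. of_nat CARD('a ^ 2) * (if x \<odot> y = z then 1 else (0 :: complex)))"
    by (subst card_triples_eq_sum) (simp_all only: finite sum_distrib_left)
  also have "\<dots> = (\<Sum>x\<in>X. \<Sum>y\<in>Y. \<Sum>z\<in>Z. if snd x ** snd y = snd z
       then \<Sum>\<xi>\<in>UNIV. \<psi> (dot (snd z *v \<xi>) (fst x + snd x *v fst y - fst z)) else 0)"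
    by (intro sum.cong refl detect)
  also have "\<dots> = (\<Sum>k\<in>SO2. \<Sum>l\<in>SO2. \<Sum>u\<in>fiber X (l ** transpose k). \<Sum>v\<in>fiber Y k. \<Sum>w\<in>fiber Z l.
      \<Sum>\<xi>\<in>UNIV. \<psi> (dot (l *v \<xi>) u) * \<psi> (dot (k *v \<xi>) v) * cnj (\<psi> (dot (l *v \<xi>) w)))"
    unfolding sum_matching_triples_eq_sum_fibers[OF assms]
    by (intro sum.cong refl) (simp only: fst_conv snd_conv phase)
  also have "\<dots> = (\<Sum>k\<in>SO2. \<Sum>l\<in>SO2. \<Sum>\<xi>\<in>UNIV. ft (fiber X (l ** transpose k)) (l *v \<xi>) *
                 ft (fiber Y k) (k *v \<xi>) * cnj (ft (fiber Z l) (l *v \<xi>)))"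
    by (simp only: sum_product3_swap ft_def cnj_sum)
  also have "\<dots> = (\<Sum>k\<in>SO2. \<Sum>\<xi>\<in>UNIV. \<Sum>l\<in>SO2. ft (fiber X (l ** transpose k)) (l *v \<xi>) *
                 ft (fiber Y k) (k *v \<xi>) * cnj (ft (fiber Z l) (l *v \<xi>)))"
    by (intro sum.cong refl sum.swap)
  also have "\<dots> = (\<Sum>\<xi>\<in>UNIV. phase_sum X Y Z \<xi>)"
    unfolding phase_sum_def by (rule sum.swap)
  finally show ?thesis ..
qed

section \<open>Square-mean bounds for the nonzero frequencies\<close>

definition orbit_norm :: "'a motion set \<Rightarrow> 'a ^ 2 \<Rightarrow> real" where
  "orbit_norm Y \<xi> = L2_set (\<lambda>h. cmod (ft (fiber Y h) (h *v \<xi>))) SO2"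

text \<open>Each rotation permutes the frequencies, so Plancherel applies to every fibre
  separately.\<close>

lemma sum_orbit_norm_square:
  assumes "Y \<subseteq> G0"
  shows "(\<Sum>\<xi>\<in>UNIV. (orbit_norm Y \<xi>)\<^sup>2) = CARD('a ^ 2) * card Y"
proof -
  have "(\<Sum>\<xi>\<in>UNIV. (orbit_norm Y \<xi>)\<^sup>2) = (\<Sum>\<xi>\<in>UNIV. \<Sum>h\<in>SO2. (cmod (ft (fiber Y h) (h *v \<xi>)))\<^sup>2)"
    by (simp add: orbit_norm_def L2_set_def sum_nonneg)
  also have "\<dots> = (\<Sum>h\<in>SO2. \<Sum>\<xi>\<in>UNIV. (cmod (ft (fiber Y h) (h *v \<xi>)))\<^sup>2)"
    by (rule sum.swap)
  also have "\<dots> = (\<Sum>h\<in>SO2. \<Sum>\<xi>\<in>UNIV. (cmod (ft (fiber Y h) \<xi>))\<^sup>2)"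
  proof (rule sum.cong[OF refl])
    fix h :: "'a ^ 2 ^ 2" assume "h \<in> SO2"
    thus "(\<Sum>\<xi>\<in>UNIV. (cmod (ft (fiber Y h) (h *v \<xi>)))\<^sup>2) = (\<Sum>\<xi>\<in>UNIV. (cmod (ft (fiber Y h) \<xi>))\<^sup>2)"
      by (intro sum.reindex_bij_betw[of "(*v) h"] bij_SO2)
  qed
  also have "\<dots> = CARD('a ^ 2) * card Y"
    by (simp only: plancherel card_eq_sum_fibers[OF assms] of_nat_sum sum_distrib_left of_nat_mult)
  finally show ?thesis .
qed

(* The kernel of the convolution operator on the orbit of \<xi>: its Hilbert-Schmidt norm is controlled
   by Plancherel because the rotations act freely on nonzero frequencies. *)
lemma sum_kernel_le:
  assumes "X \<subseteq> G0" "\<xi> \<noteq> 0" "(2 :: 'a) \<noteq> 0"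
  shows "(\<Sum>(k, l)\<in>SO2 \<times> SO2. (cmod (ft (fiber X (l ** transpose k)) (l *v \<xi>)))\<^sup>2) \<le> CARD('a ^ 2) * card X"
proof -
  \<comment> \<open>For fixed \<open>l\<close>, replacing \<open>k\<close> by h = l k^-1 permutes
    \<open>SO2\<close>. Afterwards the fibre depends on \<open>h\<close> alone and the frequency on
    \<open>l\<close> alone.\<close>
  have "(\<Sum>(k, l)\<in>SO2 \<times> SO2. (cmod (ft (fiber X (l ** transpose k)) (l *v \<xi>)))\<^sup>2) =
        (\<Sum>(h, l)\<in>SO2 \<times> SO2. (cmod (ft (fiber X h) (l *v \<xi>)))\<^sup>2)"
  proof -
    have "l ** transpose (transpose h ** l) = h" "transpose (l ** transpose h) ** l = h"
      if "l \<in> SO2" for h l :: "'a ^ 2 ^ 2"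
      using SO2_transpose_mult_self[OF that]
      by (metis matrix_mul_assoc matrix_mul_lid matrix_transpose_mul transpose_transpose,
          metis matrix_mul_assoc matrix_mul_rid matrix_transpose_mul transpose_transpose)
    thus ?thesis
      by (intro sum.reindex_bij_witness[of _ "\<lambda>(h, l). (transpose h ** l, l)" "\<lambda>(k, l). (l ** transpose k, l)"])
         (auto simp: SO2_mult SO2_transpose)
  qed
  also have "\<dots> = (\<Sum>h\<in>SO2. \<Sum>l\<in>SO2. (cmod (ft (fiber X h) (l *v \<xi>)))\<^sup>2)"
    by (rule sum.cartesian_product [symmetric])
  also have "\<dots> = (\<Sum>h\<in>SO2. \<Sum>\<eta>\<in>(\<lambda>l. l *v \<xi>) ` SO2. (cmod (ft (fiber X h) \<eta>))\<^sup>2)"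
  proof -
    have "inj_on (\<lambda>l. l *v \<xi>) SO2"
      by (rule inj_onI) (use assms SO2_action_free in blast)
    thus ?thesis
      by (simp add: sum.reindex)
  qed
  also have "\<dots> \<le> (\<Sum>h\<in>SO2. \<Sum>\<eta>\<in>UNIV. (cmod (ft (fiber X h) \<eta>))\<^sup>2)"
    by (intro sum_mono sum_mono2) auto
  also have "\<dots> = CARD('a ^ 2) * card X"
    by (simp only: plancherel card_eq_sum_fibers[OF assms(1)] of_nat_sum sum_distrib_left of_nat_mult)
  finally show ?thesis .
qed

text \<open>Cauchy-Schwarz over pairs (k, l) separates the kernel from the product of the
  \<open>Y\<close> and \<open>Z\<close> factors. The norm of that product splits into two orbit
  norms because each factor involves only one of the rotations.\<close>

lemma norm_phase_sum_le:
  assumes "X \<subseteq> G0" "\<xi> \<noteq> 0" "(2 :: 'a) \<noteq> 0"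
  shows "cmod (phase_sum X Y Z \<xi>) \<le> sqrt (CARD('a ^ 2) * card X) * (orbit_norm Y \<xi> * orbit_norm Z \<xi>)"
proof -
  define K where "K = (\<lambda>(k, l). cmod (ft (fiber X (l ** transpose k)) (l *v \<xi>)))"
  define B where "B k = cmod (ft (fiber Y k) (k *v \<xi>))" for k
  define C where "C l = cmod (ft (fiber Z l) (l *v \<xi>))" for l
  have "cmod (phase_sum X Y Z \<xi>) = cmod (\<Sum>(k, l)\<in>SO2 \<times> SO2. ft (fiber X (l ** transpose k)) (l *v \<xi>) *
                 ft (fiber Y k) (k *v \<xi>) * cnj (ft (fiber Z l) (l *v \<xi>)))"
    by (simp only: phase_sum_def sum.cartesian_product)
  also have "\<dots> \<le> (\<Sum>(k, l)\<in>SO2 \<times> SO2. K (k, l) * (B k * C l))"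
    by (rule sum_norm_le) (auto simp: K_def B_def C_def norm_mult)
  also have "\<dots> = (\<Sum>t\<in>SO2 \<times> SO2. \<bar>K t\<bar> * \<bar>B (fst t) * C (snd t)\<bar>)"
    by (intro sum.cong refl) (auto simp: K_def B_def C_def)
  also have "\<dots> \<le> L2_set K (SO2 \<times> SO2) * L2_set (\<lambda>t. B (fst t) * C (snd t)) (SO2 \<times> SO2)"
    by (rule L2_set_mult_ineq)
  also have "L2_set (\<lambda>t. B (fst t) * C (snd t)) (SO2 \<times> SO2) = orbit_norm Y \<xi> * orbit_norm Z \<xi>"
    unfolding orbit_norm_def L2_set_def B_def[symmetric] C_def[symmetric]
    by (simp add: power_mult_distrib sum_product sum.cartesian_product case_prod_unfold flip: real_sqrt_mult)
  also have "L2_set K (SO2 \<times> SO2) \<le> sqrt (CARD('a ^ 2) * card X)"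
    unfolding L2_set_def K_def using sum_kernel_le[OF assms] by (simp add: case_prod_unfold)
  finally show ?thesis
    by (simp add: mult_right_mono orbit_norm_def)
qed

text \<open>Subtracting \<open>M2_dot\<close> removes exactly the frequency 0. The rest is bounded
  frequency by frequency, followed by Cauchy-Schwarz over \<xi>.\<close>

lemma incidence_bound:
  fixes X Y Z :: "'a motion set"
  assumes "X \<subseteq> G0" "Y \<subseteq> G0" "Z \<subseteq> G0" "(2 :: 'a) \<noteq> 0"
  defines "N \<equiv> real CARD('a ^ 2)"
  shows "\<bar>N * card {(x, y, z) \<in> X \<times> Y \<times> Z. x \<odot> y = z} - M2_dot X Y Z\<bar>
           \<le> sqrt (N * card X) * (sqrt (N * card Y) * sqrt (N * card Z))"
proof -
  let ?r = "N * real (card {(x, y, z) \<in> X \<times> Y \<times> Z. x \<odot> y = z}) - real (M2_dot X Y Z)"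
  have "complex_of_real ?r = (\<Sum>\<xi>\<in>UNIV. phase_sum X Y Z \<xi>) - phase_sum X Y Z 0"
    by (simp only: N_def sum_phase_sum[OF assms(1-3)] phase_sum_0[OF assms(1-3)] of_real_diff of_real_mult of_real_of_nat_eq)
  also have "\<dots> = (\<Sum>\<xi>\<in>UNIV - {0}. phase_sum X Y Z \<xi>)"
    by (simp add: sum_diff1)
  finally have eq: "complex_of_real ?r = (\<Sum>\<xi>\<in>UNIV - {0}. phase_sum X Y Z \<xi>)" .
  have "\<bar>?r\<bar> = cmod (\<Sum>\<xi>\<in>UNIV - {0}. phase_sum X Y Z \<xi>)"
    unfolding eq [symmetric] norm_of_real ..
  also have "\<dots> \<le> (\<Sum>\<xi>\<in>UNIV - {0}. sqrt (N * card X) * (orbit_norm Y \<xi> * orbit_norm Z \<xi>))"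
    unfolding N_def by (rule sum_norm_le) (use norm_phase_sum_le[OF assms(1) _ assms(4)] in auto)
  \<comment> \<open>The frequency 0 is put back, at the cost of a nonnegative term, so that
    \<open>sum_orbit_norm_square\<close> applies.\<close>
  also have "\<dots> \<le> (\<Sum>\<xi>\<in>UNIV. sqrt (N * card X) * (orbit_norm Y \<xi> * orbit_norm Z \<xi>))"
    by (intro sum_mono2) (auto simp: N_def orbit_norm_def)
  also have "\<dots> = sqrt (N * card X) * (\<Sum>\<xi>\<in>UNIV. \<bar>orbit_norm Y \<xi>\<bar> * \<bar>orbit_norm Z \<xi>\<bar>)"
    by (simp add: sum_distrib_left orbit_norm_def)
  also have "\<dots> \<le> sqrt (N * card X) * (L2_set (orbit_norm Y) UNIV * L2_set (orbit_norm Z) UNIV)"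
    by (intro mult_left_mono L2_set_mult_ineq) (simp add: N_def)
  also have "L2_set (orbit_norm Y) UNIV = sqrt (N * card Y)"
    by (simp only: L2_set_def sum_orbit_norm_square[OF assms(2)] N_def of_nat_mult)
  also have "L2_set (orbit_norm Z) UNIV = sqrt (N * card Z)"
    by (simp only: L2_set_def sum_orbit_norm_square[OF assms(3)] N_def of_nat_mult)
  finally show ?thesis .
qed

end

theorem theorem6:
  fixes q :: nat
    and X Y Z :: "'a::{field, finite} motion set"
  assumes "primepow q" and "odd q" and "CARD('a) = q"
    and "X \<subseteq> G0" and "Y \<subseteq> G0" and "Z \<subseteq> G0"
  shows "\<bar>real (card {(x, y, z) \<in> X \<times> Y \<times> Z. x \<odot> y = z}) - real (M2_dot X Y Z) / (real q)\<^sup>2\<bar>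
           \<le> real q * sqrt (real (card X) * real (card Y) * real (card Z))"
proof -
  obtain \<psi> :: "'a \<Rightarrow> complex" where "additive_character \<psi>"
    using exists_nontrivial_additive_character[where ?'a = 'a] by (auto simp: additive_character_def)
  then interpret additive_character \<psi> .
  have N: "real CARD('a ^ 2) = (real q)\<^sup>2"
    using \<open>CARD('a) = q\<close> by simp
  have two: "(2 :: 'a) \<noteq> 0"
    using assms(2,3) by (intro two_neq_zero_if_odd_CARD) simp
  have "q > 0"
    using \<open>odd q\<close> by (rule odd_pos)
  let ?T = "real (card {(x, y, z) \<in> X \<times> Y \<times> Z. x \<odot> y = z})"
  \<comment> \<open>Clear the denominator: the three square roots in \<open>incidence_bound\<close>
    contribute q^3, and division by q^2 leaves the factor \<open>q\<close>.\<close>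
  have "(real q)\<^sup>2 * \<bar>?T - real (M2_dot X Y Z) / (real q)\<^sup>2\<bar> =
      \<bar>(real q)\<^sup>2 * (?T - real (M2_dot X Y Z) / (real q)\<^sup>2)\<bar>"
    by (simp add: abs_mult)
  also have "\<dots> = \<bar>(real q)\<^sup>2 * ?T - real (M2_dot X Y Z)\<bar>"
    using \<open>q > 0\<close> by (simp add: right_diff_distrib)
  also have "\<dots> \<le> sqrt ((real q)\<^sup>2 * card X) * (sqrt ((real q)\<^sup>2 * card Y) * sqrt ((real q)\<^sup>2 * card Z))"
    using incidence_bound[OF assms(4-6) two] unfolding N .
  also have "\<dots> = (real q)\<^sup>2 * (real q * sqrt (real (card X) * real (card Y) * real (card Z)))"
    by (simp add: real_sqrt_mult power2_eq_square)
  finally show ?thesis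
    using \<open>q > 0\<close> by (simp only: mult_le_cancel_left_pos zero_less_power of_nat_0_less_iff)
qed

end
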